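(* Let $b$ be a prime, $m,s,\alpha\in\mathbb{N}$ with $\alpha\ge2$, let $(\gamma_j)_{j\in\mathbb{N}}$ be a sequence of non-negative reals, and let $\gamma_u=\prod_{j\in u}\gamma_j$ be the associated product weights. Let $p\in\mathbb{F}_b[x]$ with $\deg(p)=m$ and $\boldsymbol{q}_s^*=(q_1^*,\ldots,q_s^* )\in(G_{b,m}^* )^s$ be found by the component-by-component algorithm, i.e.: $p$ is irreducible, $q_1^*=1$, and for each $2\le d\le s$ the component $q_d^*$ minimizes $q_d\mapsto B_{\boldsymbol{\gamma}}(p,(q_1^*,\ldots,q_{d-1}^*,q_d))$ over $q_d\in G_{b,m}^*$. Write $\boldsymbol{q}_d^*=(q_1^*,\ldots,q_d^* )$. Then for every $1\le d\le s$, $$B_{\boldsymbol{\gamma}}(p,\boldsymbol{q}_d^* )\le\frac{1}{(b^m-1)^{1/\lambda}}\prod_{j=1}^d\left[1+\gamma_j^\lambda C_\alpha^\lambda E_{\alpha,\lambda}\right]^{1/\lambda}$$ holds for any $1/\alpha<\lambda\le1$.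
   Context: $\mathbb{F}_b$ is identified with $\{0,\ldots,b-1\}$. $G_{b,m}=\{q\in\mathbb{F}_b[x]:\deg q<m\}$, $G_{b,m}^*=G_{b,m}\setminus\{0\}$. For $k\in\mathbb{N}_0$ with $b$-adic expansion $k=\kappa_0+\kappa_1b+\cdots$, $\mathrm{tr}_m(k)=\kappa_0+\kappa_1x+\cdots+\kappa_{m-1}x^{m-1}\in G_{b,m}$ (applied componentwise to vectors). For $d\in\mathbb{N}$, $p\in\mathbb{F}_b[x]$ with $\deg p=m$ and $\boldsymbol{q}\in(G_{b,m}^* )^d$, the dual polynomial lattice is $P^\perp(p,\boldsymbol{q})=\{\boldsymbol{k}\in\mathbb{N}_0^d:\mathrm{tr}_m(\boldsymbol{k})\cdot\boldsymbol{q}\equiv0\pmod p\}$, and for $\emptyset\ne u\subseteq\{1,\ldots,d\}$, $P_u^\perp(p,\boldsymbol{q})=\{\boldsymbol{k}_u\in\mathbb{N}^{|u|}:(\boldsymbol{k}_u,\boldsymbol{0})\in P^\perp(p,\boldsymbol{q})\}$, where $(\boldsymbol{k}_u,\boldsymbol{0})$ has components $k_j$ for $j\in u$ and $0$ otherwise. For $k=\kappa_1b^{a_1-1}+\cdots+\kappa_vb^{a_v-1}\in\mathbb{N}$ with $a_1>\cdots>a_v>0$ and $\kappa_i\in\{1,\ldots,b-1\}$, $\mu_\alpha(k)=a_1+\cdots+a_{\min(v,\alpha)}$; $\mu_\alpha(0)=0$; for vectors $\mu_\alpha(\boldsymbol{k})=\sum_j\mu_\alpha(k_j)$. The quality criterion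 for $\boldsymbol{q}\in(G^*_{b,m})^d$ is $$B_{\boldsymbol{\gamma}}(p,\boldsymbol{q})=\sum_{\emptyset\ne u\subseteq\{1,\ldots,d\}}\gamma_uC_\alpha^{|u|}\sum_{\substack{\boldsymbol{k}_u\in P_u^\perp(p,\boldsymbol{q})\\ \exists j\in u:\ b^m\nmid k_j}}b^{-\mu_\alpha(\boldsymbol{k}_u)},\qquad m=\deg(p),$$ with $$C_\alpha=\max\left(\frac{2}{(2\sin\frac{\pi}{b})^\alpha},\max_{1\le z\le\alpha-1}\frac{1}{(2\sin\frac{\pi}{b})^z}\right)\left(1+\frac1b+\frac1{b(b+1)}\right)^{\alpha-2}\left(3+\frac2b+\frac{2b+1}{b-1}\right).$$ For $1/\alpha<\lambda\le1$, $$E_{\alpha,\lambda}=\sum_{k=1}^\infty b^{-\lambda\mu_\alpha(k)}=\sum_{w=1}^{\alpha-1}\prod_{i=1}^w\left(\frac{b-1}{b^{\lambda i}-1}\right)+\left(\frac{b^{\lambda\alpha}-1}{b^{\lambda\alpha}-b}\right)\prod_{i=1}^\alpha\left(\frac{b-1}{b^{\lambda i}-1}\right).$$ *)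

theory Defs
  imports
    "HOL-Analysis.Analysis"
    "HOL-Number_Theory.Cong"
    "Berlekamp_Zassenhaus.Finite_Field"
begin

text \<open>
  The field with \<open>b\<close> elements, for a prime \<open>b\<close>, is \<open>'b mod_ring\<close> with \<open>'b :: prime_card\<close> and
  \<open>b = CARD('b)\<close>; a digit \<open>\<kappa> \<in> {0, \<dots>, b - 1}\<close> is identified with the field element \<open>of_nat \<kappa>\<close>.
  Vectors with components indexed by \<open>1, \<dots>, d\<close> are functions on \<open>nat\<close>. Where vectors are
  collected into a set, they are extensional, so that each vector occurs exactly once.
\<close>

text \<open>The first disjunct matters for \<open>m = 0\<close> only, since \<open>degree 0 = 0\<close> in the library.\<close>

definition polys_below :: "nat \<Rightarrow> 'b::prime_card mod_ring poly set" where
  "polys_below m = {q. q = 0 \<or> degree q < m}"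

definition polys_below_nz :: "nat \<Rightarrow> 'b::prime_card mod_ring poly set" where
  "polys_below_nz m = polys_below m - {0}"

definition digit :: "nat \<Rightarrow> nat \<Rightarrow> nat \<Rightarrow> nat" where
  "digit b k i = k div b ^ i mod b"

definition trunc :: "nat \<Rightarrow> nat \<Rightarrow> 'b::prime_card mod_ring poly" where
  "trunc m k = (\<Sum>i<m. Polynomial.monom (of_nat (digit CARD('b) k i)) i)"

definition dual_lattice ::
    "nat \<Rightarrow> 'b::prime_card mod_ring poly \<Rightarrow> (nat \<Rightarrow> 'b mod_ring poly) \<Rightarrow> (nat \<Rightarrow> nat) set" where
  "dual_lattice d p q =
     {k \<in> {1..d} \<rightarrow>\<^sub>E UNIV. [(\<Sum>j\<in>{1..d}. trunc (degree p) (k j) * q j) = 0] (mod p)}"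

definition dual_lattice_proj ::
    "nat \<Rightarrow> 'b::prime_card mod_ring poly \<Rightarrow> (nat \<Rightarrow> 'b mod_ring poly) \<Rightarrow> nat set \<Rightarrow> (nat \<Rightarrow> nat) set"
  where
  "dual_lattice_proj d p q u =
     {k \<in> u \<rightarrow>\<^sub>E {1..}. (\<lambda>j\<in>{1..d}. if j \<in> u then k j else 0) \<in> dual_lattice d p q}"

text \<open>
  The set below consists of the exponents \<open>a\<^sub>1 > \<dots> > a\<^sub>v > 0\<close> of the expansion
  \<open>k = \<kappa>\<^sub>1 b^(a\<^sub>1 - 1) + \<dots> + \<kappa>\<^sub>v b^(a\<^sub>v - 1)\<close> with nonzero \<open>\<kappa>\<^sub>i\<close>; it is finite whenever \<open>b \<ge> 2\<close>.
\<close>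

definition mu :: "nat \<Rightarrow> nat \<Rightarrow> nat \<Rightarrow> nat" where
  "mu b \<alpha> k = sum_list (take \<alpha> (rev (sorted_list_of_set {a. 0 < a \<and> digit b k (a - 1) \<noteq> 0})))"

definition mu_vec :: "nat \<Rightarrow> nat \<Rightarrow> nat set \<Rightarrow> (nat \<Rightarrow> nat) \<Rightarrow> nat" where
  "mu_vec b \<alpha> u k = (\<Sum>j\<in>u. mu b \<alpha> (k j))"

text \<open>For \<open>\<alpha> \<ge> 2\<close> the inner maximum is over a nonempty set and \<open>\<alpha> - 2\<close> does not truncate.\<close>

definition C_const :: "nat \<Rightarrow> nat \<Rightarrow> real" where
  "C_const b \<alpha> =
     max (2 / (2 * sin (pi / real b)) ^ \<alpha>)
         (Max ((\<lambda>z. 1 / (2 * sin (pi / real b)) ^ z) ` {1..\<alpha> - 1}))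
     * (1 + 1 / real b + 1 / (real b * (real b + 1))) ^ (\<alpha> - 2)
     * (3 + 2 / real b + (2 * real b + 1) / (real b - 1))"

definition E_const :: "nat \<Rightarrow> nat \<Rightarrow> real \<Rightarrow> real" where
  "E_const b \<alpha> lam = (\<Sum>\<^sub>\<infinity>k\<in>{1..}. real b powr (- lam * real (mu b \<alpha> k)))"

definition B_crit ::
    "nat \<Rightarrow> (nat set \<Rightarrow> real) \<Rightarrow> nat \<Rightarrow> 'b::prime_card mod_ring poly \<Rightarrow> (nat \<Rightarrow> 'b mod_ring poly) \<Rightarrow> real"
  where
  "B_crit \<alpha> \<gamma> d p q =
     (\<Sum>u\<in>Pow {1..d} - {{}}. \<gamma> u * C_const CARD('b) \<alpha> ^ card u *
        (\<Sum>\<^sub>\<infinity>k\<in>{k \<in> dual_lattice_proj d p q u. \<exists>j\<in>u. \<not> CARD('b) ^ degree p dvd k j}.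
           real CARD('b) powr (- real (mu_vec CARD('b) \<alpha> u k))))"

definition product_weight :: "(nat \<Rightarrow> real) \<Rightarrow> nat set \<Rightarrow> real" where
  "product_weight \<gamma> u = (\<Prod>j\<in>u. \<gamma> j)"

text \<open>
  The vector \<open>q\<close> is a possible output of the component-by-component algorithm. The criterion
  \<open>B_crit \<alpha> \<gamma> d\<close> only reads the components \<open>1, \<dots>, d\<close>, so \<open>q(d := r)\<close> stands for the
  \<open>d\<close>-dimensional vector with components \<open>q 1, \<dots>, q (d - 1), r\<close>.
\<close>

definition cbc_output ::
    "nat \<Rightarrow> (nat set \<Rightarrow> real) \<Rightarrow> nat \<Rightarrow> 'b::prime_card mod_ring poly \<Rightarrow> (nat \<Rightarrow> 'b mod_ring poly) \<Rightarrow> bool"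
  where
  "cbc_output \<alpha> \<gamma> s p q \<longleftrightarrow>
     Factorial_Ring.irreducible p \<and> q 1 = 1 \<and>
     (\<forall>d\<in>{2..s}. is_arg_min (\<lambda>r. B_crit \<alpha> \<gamma> d p (q(d := r)))
                    (\<lambda>r. r \<in> polys_below_nz (degree p)) (q d))"

end

theory Submission
  imports Defs
begin

text \<open>
  Write \<open>N = b ^ m\<close>, \<open>g j = \<gamma> j * C\<close>, and give a coordinate \<open>k j\<close> the weight \<open>1\<close> if it is zero and
  \<open>g j * b powr (- \<mu>\<^sub>\<alpha> (k j))\<close> otherwise (\<open>coord_weight\<close>). For product weights the criterion then is one
  sum \<open>B d\<close> of products of coordinate weights, over the points of the dual lattice in \<open>\<nat>\<^sub>0\<^sup>d\<close> with
  some coordinate not divisible by \<open>N\<close> (\<open>B_crit_eq_infsum_lattice_points\<close>). All these sums, and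
  those with the weights raised to the power \<open>lam\<close>, converge since \<open>1 / \<alpha> < lam\<close> (\<open>summable_mu\<close>).

  The claim is equivalent to \<open>B d powr lam \<le> (\<Prod>j = 1..d. S j) / (N - 1)\<close>, where
  \<open>S j = 1 + g j powr lam * E\<close> is the sum of the \<open>lam\<close>-th powers of the weights of coordinate \<open>j\<close> over
  \<open>\<nat>\<^sub>0\<close>, and it is proved by induction on \<open>d\<close>. For \<open>d = 1\<close> the sum is empty because \<open>q 1 = 1\<close>.

  In the induction step the points are split according to whether \<open>N\<close> divides the last coordinate. If it
  does, the truncation of that coordinate is zero, and the points contribute \<open>B d\<close> times the sum \<open>D\<close> of
  the weights of the multiples of \<open>N\<close> (\<open>infsum_lattice_points_Suc\<close>), whatever the new component is. The
  remaining sum \<open>\<theta>\<close> is what the algorithm minimises, so \<open>\<theta> powr lam\<close> at the minimiser is at most its average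
  over all \<open>N - 1\<close> candidates. By Jensen's inequality \<open>infsum_powr_le\<close> the power may be applied to the
  single terms, and since \<open>p\<close> is irreducible every vector \<open>k\<close> occurs for at most one candidate
  (\<open>sum_active_points_le\<close>). So the average is at most the sum over the non-multiples of \<open>N\<close>
  times \<open>S 1 * \<dots> * S d / (N - 1)\<close>. By the induction hypothesis \<open>(D * B d) powr lam\<close> is bounded by the same
  expression for the multiples of \<open>N\<close>. The two parts together make up \<open>S (d + 1)\<close> (\<open>cbc_step\<close>).
\<close>

section \<open>Base-\<open>b\<close> digits\<close>

lemma digit_mod_power:
  assumes "b > 0" "i < M"
  shows "digit b (k mod b ^ M) i = digit b k i"
proof -
  obtain n where M: "M = i + Suc n" using assms less_imp_Suc_add by fastforce
  have "k mod (b ^ i * b ^ Suc n) div b ^ i = k div b ^ i mod b ^ Suc n"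
    using assms by (simp only: mod_mult2_eq) simp
  then have "k mod b ^ M div b ^ i = k div b ^ i mod b ^ Suc n"
    by (simp only: M power_add)
  then show ?thesis unfolding digit_def by (simp add: mod_mod_cancel)
qed

lemma mod_power_eq_if_digits_eq:
  assumes "\<And>i. i < M \<Longrightarrow> digit b k i = digit b l i"
  shows "k mod b ^ M = l mod b ^ M"
  using assms
proof (induction M)
  case (Suc M)
  have "n mod b ^ Suc M = b ^ M * digit b n M + n mod b ^ M" for n
    by (simp add: digit_def mod_mult2_eq power_commutes[symmetric] mult.commute[of b])
  then show ?case using Suc by simp
qed simp

lemma digit_top:
  assumes "c < b" "k < b ^ M"
  shows "digit b (c * b ^ M + k) i = (if i = M then c else digit b k i)"
proof (cases i M rule: linorder_cases)
  case less
  then have "digit b (c * b ^ M + k) i = digit b ((c * b ^ M + k) mod b ^ M) i"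
    using assms by (intro digit_mod_power[symmetric]) auto
  then show ?thesis using less assms by simp
next
  case equal
  then show ?thesis using assms by (simp add: digit_def)
next
  case greater
  have *: "c * b ^ M + k < b ^ i"
  proof -
    have "c * b ^ M + k < Suc c * b ^ M" using assms by simp
    also have "\<dots> \<le> b * b ^ M" using assms by (intro mult_le_mono1) simp
    also have "\<dots> = b ^ Suc M" by simp
    also have "\<dots> \<le> b ^ i" using greater assms by (intro power_increasing) auto
    finally show ?thesis .
  qed
  then have "k < b ^ i" by simp
  then show ?thesis using greater * by (simp add: digit_def)
qed

section \<open>Convergence of the weighted sums\<close>

lemma mu_0 [simp]: "mu b \<alpha> 0 = 0"
  by (simp add: mu_def digit_def)

lemma mu_order_0 [simp]: "mu b 0 k = 0"
  by (simp add: mu_def)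

text \<open>
  The leading digit of \<open>k\<close> contributes its position, and what is left of \<open>k\<close> is then counted
  with one exponent less. So sums over all \<open>k < b ^ M\<close> satisfy a recursion in \<open>M\<close> and in the number of
  counted exponents.
\<close>

lemma mu_leading_digit:
  assumes "0 < c" "c < b" "k < b ^ M"
  shows "mu b (Suc \<alpha>) (c * b ^ M + k) = Suc M + mu b \<alpha> k"
proof -
  define D where "D = (\<lambda>k. {a. 0 < a \<and> digit b k (a - 1) \<noteq> 0})"
  have D_less: "a < Suc M" if "a \<in> D k" for a
  proof (rule ccontr)
    assume "\<not> a < Suc M"
    then have "b ^ M \<le> b ^ (a - 1)" using assms by (intro power_increasing) auto
    then have "k < b ^ (a - 1)" using assms by linarith
    then have "digit b k (a - 1) = 0" by (simp add: digit_def)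
    then show False using that by (simp add: D_def)
  qed
  then have fin: "finite (D k)"
    by (meson finite_lessThan finite_subset lessThan_iff subsetI)
  have D_insert: "D (c * b ^ M + k) = insert (Suc M) (D k)"
    using assms by (auto simp: D_def digit_top split: if_splits)
  have "sorted_list_of_set (insert (Suc M) (D k)) = insort (Suc M) (sorted_list_of_set (D k))"
    using fin D_less by (subst sorted_list_of_set_insert) auto
  also have "\<dots> = sorted_list_of_set (D k) @ [Suc M]"
    using fin D_less by (intro sorted_insort_is_snoc) (auto intro: less_imp_le)
  finally show ?thesis
    unfolding mu_def using D_insert by (simp add: D_def)
qed

text \<open>
  The numbers below \<open>b ^ (M + 1)\<close> are grouped by their digit at position \<open>M\<close>: digit zero gives
  the numbers below \<open>b ^ M\<close>, and each of the \<open>b - 1\<close> other digits is a leading digit.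
\<close>

lemma sum_mu_recursion:
  fixes x :: real
  assumes "b > 0"
  shows "(\<Sum>k<b ^ Suc M. x ^ mu b (Suc \<alpha>) k) =
    (\<Sum>k<b ^ M. x ^ mu b (Suc \<alpha>) k) + (real b - 1) * x ^ Suc M * (\<Sum>k<b ^ M. x ^ mu b \<alpha> k)"
proof -
  let ?f = "\<lambda>k. x ^ mu b (Suc \<alpha>) k"
  obtain n where b: "b = Suc n" using assms gr0_conv_Suc by auto
  have block: "sum ?f {c * b ^ M ..< c * b ^ M + b ^ M} = (\<Sum>k<b ^ M. ?f (c * b ^ M + k))" for c
    by (simp add: sum.atLeastLessThan_shift_0[of _ "c * b ^ M"] atLeast0LessThan)
  have lead: "(\<Sum>k<b ^ M. ?f (Suc c * b ^ M + k)) = x ^ Suc M * (\<Sum>k<b ^ M. x ^ mu b \<alpha> k)"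
    if "c < n" for c
    unfolding sum_distrib_left using that b
    by (intro sum.cong refl) (simp only: mu_leading_digit lessThan_iff power_add zero_less_Suc Suc_less_eq)
  have "(\<Sum>k<b ^ Suc M. ?f k) = (\<Sum>c<b. \<Sum>k<b ^ M. ?f (c * b ^ M + k))"
    by (simp add: block[symmetric] sum.nat_group)
  also have "\<dots> = (\<Sum>k<b ^ M. ?f k) + (\<Sum>c<n. \<Sum>k<b ^ M. ?f (Suc c * b ^ M + k))"
    unfolding b by (subst sum.lessThan_Suc_shift) simp
  also have "(\<Sum>c<n. \<Sum>k<b ^ M. ?f (Suc c * b ^ M + k)) =
      real n * (x ^ Suc M * (\<Sum>k<b ^ M. x ^ mu b \<alpha> k))"
    using lead by simp
  finally show ?thesis using b by simp
qed

text \<open>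
  Without any exponent counted the sum over the numbers below \<open>b ^ M\<close> has \<open>b ^ M \<le> t ^ (A M)\<close>
  terms equal to \<open>1\<close>. Each additional counted exponent saves a factor \<open>t ^ M\<close>, because in
  \<open>sum_mu_recursion\<close> the factor \<open>x ^ M\<close> turns \<open>t ^ ((A - i) M)\<close> into
  \<open>(x t) ^ M * t ^ ((A - i - 1) M)\<close> and \<open>x t < 1\<close> makes the resulting increments summable.
  With \<open>A\<close> counted exponents the partial sums are bounded.
\<close>

lemma sum_mu_growth:
  fixes x t :: real
  assumes "b > 0" "x > 0" "t \<ge> 1" "x * t < 1" "real b \<le> t ^ A" "i \<le> A"
  shows "\<exists>K\<ge>0. \<forall>M. (\<Sum>k<b ^ M. x ^ mu b i k) \<le> K * t ^ ((A - i) * M)"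
  using \<open>i \<le> A\<close>
proof (induction i)
  case 0
  have "real (b ^ M) \<le> 1 * t ^ (A * M)" for M
    using power_mono[OF \<open>real b \<le> t ^ A\<close>, of M] by (simp add: power_mult)
  then show ?case by (intro exI[of _ 1]) simp
next
  case (Suc i)
  then obtain K where K: "K \<ge> 0" "\<And>M. (\<Sum>k<b ^ M. x ^ mu b i k) \<le> K * t ^ ((A - i) * M)"
    by auto
  define e where "e = A - Suc i"
  have e: "A - i = Suc e" using Suc.prems by (simp add: e_def)
  define L where "L = (real b - 1) * x * K"
  have L: "L \<ge> 0" using assms K by (simp add: L_def)
  let ?c = "x * t"
  have c: "0 < ?c" "?c < 1" using assms by auto
  have partial: "(\<Sum>k<b ^ M. x ^ mu b (Suc i) k) \<le> (1 + L * (\<Sum>n<M. ?c ^ n)) * t ^ (e * M)" for M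
  proof (induction M)
    case (Suc M)
    have c_pow: "?c ^ n \<ge> 0" for n using less_imp_le[OF c(1)] by (rule zero_le_power)
    have "(real b - 1) * x ^ Suc M * (\<Sum>k<b ^ M. x ^ mu b i k)
        \<le> (real b - 1) * x ^ Suc M * (K * t ^ (Suc e * M))"
      using K(2)[of M] assms e by (intro mult_left_mono) auto
    also have "\<dots> = L * ?c ^ M * t ^ (e * M)"
      by (simp add: L_def power_mult_distrib power_add algebra_simps)
    finally have "(\<Sum>k<b ^ Suc M. x ^ mu b (Suc i) k)
        \<le> (1 + L * (\<Sum>n<M. ?c ^ n)) * t ^ (e * M) + L * ?c ^ M * t ^ (e * M)"
      using Suc sum_mu_recursion[OF \<open>b > 0\<close>, where x = x and M = M and \<alpha> = i] by simp
    also have "\<dots> = (1 + L * (\<Sum>n<Suc M. ?c ^ n)) * t ^ (e * M)"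
      by (simp add: algebra_simps)
    also have "\<dots> \<le> (1 + L * (\<Sum>n<Suc M. ?c ^ n)) * t ^ (e * Suc M)"
    proof (rule mult_left_mono)
      have "L * (\<Sum>n<Suc M. ?c ^ n) \<ge> 0"
        by (intro mult_nonneg_nonneg L sum_nonneg c_pow)
      then show "1 + L * (\<Sum>n<Suc M. ?c ^ n) \<ge> 0" by linarith
    qed (use assms in \<open>auto intro: power_increasing\<close>)
    finally show ?case .
  qed simp
  have geo: "(\<Sum>n<M. ?c ^ n) \<le> 1 / (1 - ?c)" for M
    using c zero_le_power[OF less_imp_le[OF c(1)], of M]
    by (subst sum_gp_strict) (auto intro!: divide_right_mono simp del: power_mult_distrib)
  have "(\<Sum>k<b ^ M. x ^ mu b (Suc i) k) \<le> (1 + L * (1 / (1 - ?c))) * t ^ (e * M)" for M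
    using partial[of M]
  proof (rule order_trans)
    show "(1 + L * (\<Sum>n<M. ?c ^ n)) * t ^ (e * M) \<le> (1 + L * (1 / (1 - ?c))) * t ^ (e * M)"
      using assms geo[of M] L by (intro mult_right_mono add_left_mono mult_left_mono) auto
  qed
  then show ?case using L c by (intro exI[of _ "1 + L * (1 / (1 - ?c))"]) (simp add: e_def)
qed

text \<open>
  The growth estimate applies with \<open>x = b powr (- lam)\<close> and \<open>t = b powr (1 / \<alpha>)\<close>, the smallest
  \<open>t\<close> with \<open>b \<le> t ^ \<alpha>\<close>; then \<open>x t < 1\<close> says exactly that \<open>1 / \<alpha> < lam\<close>.
\<close>

lemma summable_mu:
  assumes "b > 1" "\<alpha> > 0" "1 / real \<alpha> < lam"
  shows "(\<lambda>k. real b powr (- lam * real (mu b \<alpha> k))) summable_on UNIV"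
proof -
  define x where "x = real b powr (- lam)"
  define t where "t = real b powr (1 / real \<alpha>)"
  have x: "x > 0" and t: "t \<ge> 1" using assms by (auto simp: x_def t_def ge_one_powr_ge_zero)
  have "x * t = real b powr (1 / real \<alpha> - lam)" by (simp add: x_def t_def powr_add[symmetric])
  also have "\<dots> < real b powr 0" using assms by (intro powr_less_mono) auto
  finally have xt: "x * t < 1" using assms by simp
  have "t ^ \<alpha> = real b" using assms by (simp add: t_def powr_power)
  then obtain K where K: "\<And>M. (\<Sum>k<b ^ M. x ^ mu b \<alpha> k) \<le> K"
    using sum_mu_growth[OF _ x t xt, of b \<alpha> \<alpha>] assms by auto
  have "(\<lambda>k. x ^ mu b \<alpha> k) summable_on UNIV"
  proof (rule nonneg_bdd_above_summable_on)
    show "bdd_above (sum (\<lambda>k. x ^ mu b \<alpha> k) ` {F. F \<subseteq> UNIV \<and> finite F})"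
    proof (rule bdd_aboveI2[where M = K])
      fix F :: "nat set"
      assume "F \<in> {F. F \<subseteq> UNIV \<and> finite F}"
      then obtain M where M: "F \<subseteq> {..<M}" using finite_nat_iff_bounded by auto
      have "M < b ^ M" using assms by (intro power_gt_expt) auto
      then have "F \<subseteq> {..<b ^ M}" using M by auto
      then have "(\<Sum>k\<in>F. x ^ mu b \<alpha> k) \<le> (\<Sum>k<b ^ M. x ^ mu b \<alpha> k)"
        using x by (intro sum_mono2) auto
      then show "(\<Sum>k\<in>F. x ^ mu b \<alpha> k) \<le> K" using K[of M] by simp
    qed
  qed (use x in auto)
  moreover have "x ^ n = real b powr (- lam * real n)" for n
    using assms by (simp add: x_def powr_power mult.commute)
  ultimately show ?thesis by simp
qed

section \<open>Infinite sums: powers and products\<close>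

text \<open>
  Jensen's inequality for sums: if \<open>s\<close> is the total, each quotient \<open>a k / s\<close> lies in \<open>[0, 1]\<close>, so raising
  it to a power \<open>lam \<le> 1\<close> can only increase it, while these quotients add up to \<open>1\<close>. The case of a
  total \<open>0\<close>, which is also the default value of a divergent sum, is trivial.
\<close>

lemma infsum_powr_le:
  fixes a :: "'a \<Rightarrow> real"
  assumes lam: "0 < lam" "lam \<le> 1" and nonneg: "\<And>k. k \<in> A \<Longrightarrow> a k \<ge> 0"
    and summable: "(\<lambda>k. a k powr lam) summable_on A"
  shows "infsum a A powr lam \<le> infsum (\<lambda>k. a k powr lam) A"
proof (cases "a summable_on A \<and> infsum a A > 0")
  case True
  define s where "s = infsum a A"
  have s: "s > 0" and a: "a summable_on A" using True by (auto simp: s_def)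
  have le: "a k \<le> s" if "k \<in> A" for k
    unfolding s_def using finite_sum_le_infsum[OF a, of "{k}"] that nonneg by simp
  \<comment> \<open>The inequality \<open>a k / s \<le> (a k / s) powr lam\<close>, multiplied by \<open>s powr lam\<close>.\<close>
  have termwise: "s powr (lam - 1) * a k \<le> a k powr lam" if "k \<in> A" for k
  proof (cases "a k = 0")
    case False
    then have ak: "a k > 0" using nonneg[OF that] by simp
    have "s powr (lam - 1) \<le> a k powr (lam - 1)"
      using ak le[OF that] lam by (intro powr_mono2') auto
    then have "s powr (lam - 1) * a k \<le> a k powr (lam - 1) * a k powr 1"
      using ak by (simp add: mult_right_mono)
    also have "\<dots> = a k powr lam" by (simp only: powr_add[symmetric]) simp
    finally show ?thesis .
  qed simp
  have "s powr lam = s powr (lam - 1) * s powr 1" by (simp only: powr_add[symmetric]) simp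
  also have "\<dots> = infsum (\<lambda>k. s powr (lam - 1) * a k) A"
    using s by (simp add: infsum_cmult_right' s_def)
  also have "\<dots> \<le> infsum (\<lambda>k. a k powr lam) A"
    using termwise summable a by (intro infsum_mono summable_on_cmult_right) auto
  finally show ?thesis by (simp add: s_def)
next
  case False
  then have "infsum a A = 0"
    using infsum_nonneg[of A a] nonneg infsum_not_exists[of a A] by force
  then show ?thesis by (simp add: infsum_nonneg)
qed

lemma powr_add_le:
  fixes x y :: real
  assumes "0 < lam" "lam \<le> 1" "x \<ge> 0" "y \<ge> 0"
  shows "(x + y) powr lam \<le> x powr lam + y powr lam"
proof -
  have "infsum (\<lambda>c. if c then x else y) {True, False} powr lam
      \<le> infsum (\<lambda>c. (if c then x else y) powr lam) {True, False}"
    by (rule infsum_powr_le[OF assms(1,2)]) (use assms in auto)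
  then show ?thesis by simp
qed

lemma powr_le_average:
  fixes g :: "'a \<Rightarrow> real"
  assumes "finite R" "R \<noteq> {}" "0 \<le> lam" "0 \<le> x" "\<And>r. r \<in> R \<Longrightarrow> x \<le> g r"
  shows "x powr lam \<le> (\<Sum>r\<in>R. g r powr lam) / real (card R)"
proof -
  have "real (card R) * x powr lam = (\<Sum>r\<in>R. x powr lam)" by simp
  also have "\<dots> \<le> (\<Sum>r\<in>R. g r powr lam)"
    using assms by (intro sum_mono powr_mono2) auto
  finally show ?thesis
    using assms(1,2) by (subst pos_le_divide_eq) (auto simp: card_gt_0_iff mult.commute)
qed

text \<open>
  Fubini for weights of product form, with the fibre set \<open>X\<close> arbitrary: it is used both for full boxes
  and for the dual lattice points whose last coordinate is a multiple of \<open>b ^ m\<close>.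
\<close>

lemma has_sum_prod_insert:
  fixes f :: "'i \<Rightarrow> 'k \<Rightarrow> real"
  assumes "finite A" "x \<notin> A" "X \<subseteq> A \<rightarrow>\<^sub>E UNIV" "\<And>j k. f j k \<ge> 0"
    and X: "((\<lambda>k. \<Prod>j\<in>A. f j (k j)) has_sum S) X" and Y: "(f x has_sum T) Y"
  shows "((\<lambda>k. \<Prod>j\<in>insert x A. f j (k j)) has_sum (T * S)) ((\<lambda>(y, k). k(x := y)) ` (Y \<times> X))"
proof -
  have inj: "inj_on (\<lambda>(y, k). k(x := y)) (Y \<times> X)"
    using inj_combinator[OF \<open>x \<notin> A\<close>, of "\<lambda>_. UNIV"] by (rule inj_on_subset) (use assms in auto)
  have prod: "(\<Prod>j\<in>insert x A. f j ((k(x := y)) j)) = f x y * (\<Prod>j\<in>A. f j (k j))" for k y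
  proof -
    have "(\<Prod>j\<in>A. f j ((k(x := y)) j)) = (\<Prod>j\<in>A. f j (k j))"
      using assms by (intro prod.cong) auto
    then show ?thesis using assms by simp
  qed
  have inner: "((\<lambda>k. f x y * (\<Prod>j\<in>A. f j (k j))) has_sum (f x y * S)) X" for y
    using X by (rule has_sum_cmult_right)
  have outer: "((\<lambda>y. f x y * S) has_sum (T * S)) Y"
    using Y by (rule has_sum_cmult_left)
  have "((\<lambda>(y, k). f x y * (\<Prod>j\<in>A. f j (k j))) has_sum (T * S)) (Y \<times> X)"
  proof (rule has_sum_SigmaI)
    show "(\<lambda>(y, k). f x y * (\<Prod>j\<in>A. f j (k j))) summable_on Y \<times> X"
      using inner outer assms(4)
      by (intro summable_on_SigmaI[where g = "\<lambda>y. f x y * S"])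
         (auto intro!: mult_nonneg_nonneg prod_nonneg has_sum_imp_summable)
  qed (use inner outer in auto)
  then show ?thesis
    by (subst has_sum_reindex[OF inj]) (simp only: o_def case_prod_unfold prod)
qed

lemma has_sum_prod_PiE:
  fixes f :: "'i \<Rightarrow> 'k \<Rightarrow> real"
  assumes "finite A" "\<And>j k. f j k \<ge> 0" "\<And>j. j \<in> A \<Longrightarrow> f j summable_on UNIV"
  shows "((\<lambda>k. \<Prod>j\<in>A. f j (k j)) has_sum (\<Prod>j\<in>A. infsum (f j) UNIV)) (A \<rightarrow>\<^sub>E UNIV)"
  using assms(1,3)
proof (induction A)
  case empty
  show ?case by (simp add: has_sum_finiteI)
next
  case (insert x A)
  then show ?case
    using has_sum_prod_insert[of A x "A \<rightarrow>\<^sub>E UNIV" f, OF _ _ order.refl assms(2)]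
    by (simp add: PiE_insert_eq)
qed


section \<open>Truncated digit polynomials\<close>

lemma coeff_trunc:
  "poly.coeff (trunc m k :: 'b::prime_card mod_ring poly) i =
    (if i < m then of_nat (digit CARD('b) k i) else 0)"
  by (simp add: trunc_def Polynomial.coeff_sum if_distrib sum.delta cong: if_cong)

lemma card_gt_1: "CARD('b::prime_card) > 1"
  by (rule prime_gt_1_nat[OF prime_card])

lemma trunc_eq_iff:
  "(trunc m k :: 'b::prime_card mod_ring poly) = trunc m l \<longleftrightarrow>
    k mod CARD('b) ^ m = l mod CARD('b) ^ m"
proof
  assume eq: "(trunc m k :: 'b mod_ring poly) = trunc m l"
  show "k mod CARD('b) ^ m = l mod CARD('b) ^ m"
  proof (rule mod_power_eq_if_digits_eq)
    fix i assume i: "i < m"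
    have "(of_nat (digit CARD('b) k i) :: 'b mod_ring) = of_nat (digit CARD('b) l i)"
      using arg_cong[OF eq, of "\<lambda>q. poly.coeff q i"] i by (simp add: coeff_trunc)
    then show "digit CARD('b) k i = digit CARD('b) l i"
      by (simp add: of_nat_eq_iff_cong_CHAR cong_def digit_def)
  qed
next
  assume eq: "k mod CARD('b) ^ m = l mod CARD('b) ^ m"
  have "digit CARD('b) k i = digit CARD('b) l i" if "i < m" for i
    using digit_mod_power[of "CARD('b)" i m k] digit_mod_power[of "CARD('b)" i m l] that eq by simp
  then show "(trunc m k :: 'b mod_ring poly) = trunc m l"
    by (intro poly_eqI) (simp add: coeff_trunc)
qed

lemma trunc_0 [simp]: "trunc m 0 = 0"
  by (simp add: trunc_def digit_def)

lemma trunc_eq_0_iff: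
  "(trunc m k :: 'b::prime_card mod_ring poly) = 0 \<longleftrightarrow> CARD('b) ^ m dvd k"
  using trunc_eq_iff[of m k 0, where 'b = 'b] by (simp add: dvd_eq_mod_eq_0)

lemma polys_below_iff_coeff: "q \<in> polys_below m \<longleftrightarrow> (\<forall>i\<ge>m. poly.coeff q i = 0)"
proof
  assume "\<forall>i\<ge>m. poly.coeff q i = 0"
  then have "q = 0 \<or> degree q < m"
    by (metis leading_coeff_0_iff not_le)
  then show "q \<in> polys_below m" by (simp add: polys_below_def)
qed (auto simp: polys_below_def coeff_eq_0)

lemma trunc_in_polys_below: "trunc m k \<in> polys_below m"
  by (simp add: polys_below_iff_coeff coeff_trunc)

lemma diff_in_polys_below:
  "q \<in> polys_below m \<Longrightarrow> r \<in> polys_below m \<Longrightarrow> q - r \<in> polys_below m"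
  by (simp add: polys_below_iff_coeff)

lemma dvd_polys_below_imp_0:
  assumes "q \<in> polys_below (degree p)" "p dvd q"
  shows "q = 0"
  using assms dvd_imp_degree_le[of p q] by (cases "q = 0") (auto simp: polys_below_def)

section \<open>The criterion as a single sum over lattice points\<close>

text \<open>
  A vanishing coordinate gets weight \<open>1\<close>. Then the sum of such products over all of \<open>\<nat>\<^sub>0\<^sup>d\<close> collects
  the sums over all supports \<open>u\<close>, which turns the subset sum in the criterion into one sum.
\<close>

definition coord_weight :: "nat \<Rightarrow> nat \<Rightarrow> real \<Rightarrow> real \<Rightarrow> nat \<Rightarrow> real" where
  "coord_weight b \<alpha> lam g k = (if k = 0 then 1 else g * real b powr (- lam * real (mu b \<alpha> k)))"

lemma coord_weight_nonneg: "g \<ge> 0 \<Longrightarrow> coord_weight b \<alpha> lam g k \<ge> 0"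
  by (simp add: coord_weight_def)

lemma coord_weight_powr:
  "coord_weight b \<alpha> 1 g k powr lam = coord_weight b \<alpha> lam (g powr lam) k"
  by (simp add: coord_weight_def powr_mult powr_powr mult.commute)

lemma summable_coord_weight:
  assumes "b > 1" "\<alpha> > 0" "1 / real \<alpha> < lam" "g \<ge> 0"
  shows "coord_weight b \<alpha> lam g summable_on UNIV"
proof (rule summable_on_comparison_test)
  show "(\<lambda>k. max 1 g * real b powr (- lam * real (mu b \<alpha> k))) summable_on UNIV"
    using summable_mu[OF assms(1-3)] by (rule summable_on_cmult_right)
  show "coord_weight b \<alpha> lam g k \<le> max 1 g * real b powr (- lam * real (mu b \<alpha> k))" for k
    using assms by (auto simp: coord_weight_def intro: mult_right_mono)
qed (use assms in \<open>simp add: coord_weight_nonneg\<close>)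

lemma infsum_coord_weight:
  assumes "b > 1" "\<alpha> > 0" "1 / real \<alpha> < lam"
  shows "infsum (coord_weight b \<alpha> lam g) UNIV = 1 + g * E_const b \<alpha> lam"
proof -
  have UNIV: "UNIV = insert 0 {1::nat..}" by auto
  have "(\<lambda>k. g * real b powr (- lam * real (mu b \<alpha> k))) summable_on {1..}"
    using summable_on_subset[OF summable_mu[OF assms]] by (intro summable_on_cmult_right) auto
  then have "coord_weight b \<alpha> lam g summable_on {1..}"
    by (rule summable_on_cong[THEN iffD1, rotated]) (simp add: coord_weight_def)
  then have "infsum (coord_weight b \<alpha> lam g) UNIV =
      coord_weight b \<alpha> lam g 0 + infsum (coord_weight b \<alpha> lam g) {1..}"
    unfolding UNIV by (rule infsum_insert) simp
  also have "infsum (coord_weight b \<alpha> lam g) {1..} =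
      infsum (\<lambda>k. g * real b powr (- lam * real (mu b \<alpha> k))) {1..}"
    by (intro infsum_cong) (simp add: coord_weight_def)
  also have "\<dots> = g * E_const b \<alpha> lam"
    by (simp add: infsum_cmult_right' E_const_def)
  finally show ?thesis by (simp add: coord_weight_def[of b \<alpha> lam g 0])
qed

text \<open>
  The vectors that contribute to the criterion for some support \<open>u\<close>. Coordinates outside the support
  are \<open>0\<close> and so divisible by \<open>b ^ m\<close>, hence the non-divisibility condition need not mention \<open>u\<close>.
  In particular the zero vector is excluded.
\<close>

definition lattice_points ::
    "nat \<Rightarrow> 'b::prime_card mod_ring poly \<Rightarrow> (nat \<Rightarrow> 'b mod_ring poly) \<Rightarrow> (nat \<Rightarrow> nat) set" where
  "lattice_points d p q = {k \<in> {1..d} \<rightarrow>\<^sub>E UNIV.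
     p dvd (\<Sum>j\<in>{1..d}. trunc (degree p) (k j) * q j) \<and>
     (\<exists>j\<in>{1..d}. \<not> CARD('b) ^ degree p dvd k j)}"

lemma C_const_nonneg:
  assumes "b > 1"
  shows "C_const b \<alpha> \<ge> 0"
proof -
  have "sin (pi / real b) \<ge> 0"
    using assms by (intro sin_ge_zero) (auto simp: field_simps)
  then have "2 / (2 * sin (pi / real b)) ^ \<alpha> \<ge> 0" by simp
  then show ?thesis
    unfolding C_const_def using assms by (intro mult_nonneg_nonneg max.coboundedI1) auto
qed

text \<open>
  The lattice points are partitioned by their support \<open>u\<close>. Padding with zeros is a bijection from the
  vectors that the criterion sums over for \<open>u\<close> to the part with support \<open>u\<close>, and the factors \<open>1\<close> outside \<open>u\<close> disappear.
  Finitely many parts may be summed separately since the weight is summable on the whole box.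
\<close>

lemma B_crit_eq_infsum_lattice_points:
  fixes p :: "'b::prime_card mod_ring poly"
  defines "b \<equiv> CARD('b)"
  assumes "\<alpha> \<ge> 2" "\<And>j. j \<in> {1..d} \<Longrightarrow> \<gamma> j \<ge> 0"
  shows "B_crit \<alpha> (product_weight \<gamma>) d p q =
    infsum (\<lambda>k. \<Prod>j\<in>{1..d}. coord_weight b \<alpha> 1 (\<gamma> j * C_const b \<alpha>) (k j)) (lattice_points d p q)"
proof -
  define h where "h = (\<lambda>k. \<Prod>j\<in>{1..d}. coord_weight b \<alpha> 1 (\<gamma> j * C_const b \<alpha>) (k j))"
  \<comment> \<open>The product lemma asks for nonnegative factors at all indices, but \<open>\<gamma>\<close> is controlled only
    on \<open>{1..d}\<close>.\<close>
  define f where "f = (\<lambda>j. if j \<in> {1..d} then coord_weight b \<alpha> 1 (\<gamma> j * C_const b \<alpha>) else (\<lambda>_. 0))"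
  define L where "L = (\<lambda>u. {k \<in> lattice_points d p q. {j \<in> {1..d}. k j \<noteq> 0} = u})"
  define U where "U = Pow {1..d} - {{}}"
  have b: "b > 1" using card_gt_1 by (simp add: b_def)
  have fnn: "f j k \<ge> 0" for j k
    using assms C_const_nonneg[OF b] by (auto simp: f_def intro!: coord_weight_nonneg)
  have fsum: "f j summable_on UNIV" if "j \<in> {1..d}" for j
    using assms that C_const_nonneg[OF b] b by (auto simp: f_def intro!: summable_coord_weight)
  have "(\<lambda>k. \<Prod>j\<in>{1..d}. f j (k j)) summable_on ({1..d} \<rightarrow>\<^sub>E UNIV)"
    using fnn fsum by (intro has_sum_imp_summable[OF has_sum_prod_PiE]) auto
  also have "(\<lambda>k. \<Prod>j\<in>{1..d}. f j (k j)) = h"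
    by (auto simp: h_def f_def intro!: prod.cong)
  finally have summ: "h summable_on ({1..d} \<rightarrow>\<^sub>E UNIV)" .
  have summL: "h summable_on L u" for u
    by (rule summable_on_subset[OF summ]) (auto simp: L_def lattice_points_def)
  have part: "lattice_points d p q = (\<Union>u\<in>U. L u)"
  proof
    show "lattice_points d p q \<subseteq> (\<Union>u\<in>U. L u)"
    proof
      fix k assume k: "k \<in> lattice_points d p q"
      then obtain j where "j \<in> {1..d}" "\<not> CARD('b) ^ degree p dvd k j"
        by (auto simp: lattice_points_def)
      then have "j \<in> {j \<in> {1..d}. k j \<noteq> 0}" by (cases "k j = 0") auto
      then have "{j \<in> {1..d}. k j \<noteq> 0} \<in> U" unfolding U_def by blast
      then show "k \<in> (\<Union>u\<in>U. L u)" using k by (auto simp: L_def)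
    qed
  qed (auto simp: L_def)
  have term_u: "product_weight \<gamma> u * C_const b \<alpha> ^ card u *
        infsum (\<lambda>k. real b powr (- real (mu_vec b \<alpha> u k)))
          {k \<in> dual_lattice_proj d p q u. \<exists>j\<in>u. \<not> b ^ degree p dvd k j} = infsum h (L u)"
    if "u \<in> U" for u
  proof -
    define V where "V = {k \<in> dual_lattice_proj d p q u. \<exists>j\<in>u. \<not> b ^ degree p dvd k j}"
    define pad where "pad = (\<lambda>k::nat \<Rightarrow> nat. \<lambda>j\<in>{1..d}. if j \<in> u then k j else 0)"
    have u: "u \<subseteq> {1..d}" using that by (auto simp: U_def)
    have V_iff: "k \<in> V \<longleftrightarrow> k \<in> u \<rightarrow>\<^sub>E {1..} \<and>
        p dvd (\<Sum>j\<in>{1..d}. trunc (degree p) (pad k j) * q j) \<and> (\<exists>j\<in>u. \<not> b ^ degree p dvd k j)" for k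
      by (auto simp: V_def dual_lattice_proj_def dual_lattice_def pad_def cong_0_iff)
    have "infsum (\<lambda>k. product_weight \<gamma> u * C_const b \<alpha> ^ card u *
        real b powr (- real (mu_vec b \<alpha> u k))) V = infsum h (L u)"
    proof (rule infsum_reindex_bij_witness[where j = pad and i = "\<lambda>k. restrict k u"])
      fix k assume k: "k \<in> V"
      then have kE: "k \<in> u \<rightarrow>\<^sub>E {1..}" by (simp add: V_iff)
      have "restrict (pad k) u = restrict k u"
        using u by (intro ext) (auto simp: pad_def restrict_def)
      then show "restrict (pad k) u = k"
        using PiE_restrict[OF kE] by simp
      have supp: "{j \<in> {1..d}. pad k j \<noteq> 0} = u"
        using u kE by (fastforce simp: pad_def PiE_def Pi_def)
      have "\<exists>j\<in>{1..d}. \<not> b ^ degree p dvd pad k j"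
        using k u by (force simp: V_iff pad_def)
      then show "pad k \<in> L u"
        using k supp by (auto simp: L_def lattice_points_def V_iff b_def) (auto simp: pad_def)
      have "h (pad k) = (\<Prod>j\<in>u. coord_weight b \<alpha> 1 (\<gamma> j * C_const b \<alpha>) (k j))"
        unfolding h_def using u
        by (intro prod.mono_neutral_cong_right) (auto simp: pad_def coord_weight_def)
      also have "\<dots> = (\<Prod>j\<in>u. \<gamma> j * C_const b \<alpha> * real b powr (- real (mu b \<alpha> (k j))))"
        using kE by (intro prod.cong refl) (force simp: coord_weight_def PiE_def Pi_def)
      also have "\<dots> = product_weight \<gamma> u * C_const b \<alpha> ^ card u * real b powr (- real (mu_vec b \<alpha> u k))"
        using b finite_subset[OF u]
        by (simp add: prod.distrib product_weight_def mu_vec_def powr_sum sum_negf[symmetric])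
      finally show "h (pad k) = product_weight \<gamma> u * C_const b \<alpha> ^ card u *
        real b powr (- real (mu_vec b \<alpha> u k))" .
    next
      fix k assume k: "k \<in> L u"
      then have kE: "k \<in> {1..d} \<rightarrow>\<^sub>E UNIV" and supp: "\<And>j. j \<in> {1..d} \<Longrightarrow> k j \<noteq> 0 \<longleftrightarrow> j \<in> u"
        by (auto simp: L_def lattice_points_def)
      show pad: "pad (restrict k u) = k"
        using kE supp u by (auto simp: pad_def fun_eq_iff PiE_def extensional_def)
      have "restrict k u \<in> u \<rightarrow>\<^sub>E {1..}"
        using supp u by (auto simp: Suc_le_eq)
      moreover obtain j where "j \<in> {1..d}" "\<not> b ^ degree p dvd k j"
        using k by (auto simp: L_def lattice_points_def b_def)
      then have "\<exists>j\<in>u. \<not> b ^ degree p dvd restrict k u j"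
        using supp[of j] by (intro bexI[of _ j]) auto
      ultimately show "restrict k u \<in> V"
        using k unfolding V_iff pad by (simp add: L_def lattice_points_def)
    qed
    then show ?thesis by (simp add: infsum_cmult_right' V_def)
  qed
  have "B_crit \<alpha> (product_weight \<gamma>) d p q = (\<Sum>u\<in>U. infsum h (L u))"
    unfolding B_crit_def U_def[symmetric] b_def[symmetric] by (intro sum.cong refl term_u)
  also have "\<dots> = infsum h (lattice_points d p q)"
    unfolding part by (intro sum_infsum summL) (auto simp: U_def L_def)
  finally show ?thesis by (simp add: h_def)
qed

section \<open>One step of the component-by-component construction\<close>

text \<open>
  Only for these points does the condition of lying in the dual lattice depend on the last component
  of the generating vector, since \<open>b ^ m dvd k d\<close> makes the truncation of \<open>k d\<close> vanish.
\<close>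

definition active_points ::
    "nat \<Rightarrow> 'b::prime_card mod_ring poly \<Rightarrow> (nat \<Rightarrow> 'b mod_ring poly) \<Rightarrow> (nat \<Rightarrow> nat) set" where
  "active_points d p q = {k \<in> lattice_points d p q. \<not> CARD('b) ^ degree p dvd k d}"

lemma lattice_points_cong:
  assumes "\<And>j. j \<in> {1..d} \<Longrightarrow> q j = q' j"
  shows "lattice_points d p q = lattice_points d p q'"
  unfolding lattice_points_def using assms by simp

text \<open>
  If \<open>b ^ m\<close> divides the last coordinate, the remaining coordinates form a lattice point of one
  dimension less, and the last coordinate is otherwise free. The sum over these points factorises,
  and its second factor is the criterion for the previous dimension.
\<close>

lemma infsum_lattice_points_Suc:
  fixes p :: "'b::prime_card mod_ring poly" and f :: "nat \<Rightarrow> nat \<Rightarrow> real"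
  assumes f: "\<And>j k. f j k \<ge> 0" "\<And>j. f j summable_on UNIV"
  shows "infsum (\<lambda>k. \<Prod>j\<in>{1..Suc d}. f j (k j)) (lattice_points (Suc d) p q) =
    infsum (f (Suc d)) {y. CARD('b) ^ degree p dvd y}
      * infsum (\<lambda>k. \<Prod>j\<in>{1..d}. f j (k j)) (lattice_points d p q)
    + infsum (\<lambda>k. \<Prod>j\<in>{1..Suc d}. f j (k j)) (active_points (Suc d) p q)"
proof -
  let ?N = "CARD('b) ^ degree p"
  let ?h = "\<lambda>d k. \<Prod>j\<in>{1..d}. f j (k j)"
  define Z where "Z = (\<lambda>(y, k). k(Suc d := y)) ` ({y. ?N dvd y} \<times> lattice_points d p q)"
  have ins: "{1..Suc d} = insert (Suc d) {1..d}" by auto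
  have summ: "?h n summable_on lattice_points n p q" for n
  proof (rule summable_on_subset)
    show "?h n summable_on ({1..n} \<rightarrow>\<^sub>E UNIV)"
      using f by (intro has_sum_imp_summable[OF has_sum_prod_PiE]) auto
  qed (auto simp: lattice_points_def)
  have upd: "(\<Sum>j\<in>{1..d}. trunc (degree p) ((k(Suc d := y)) j) * q j) =
      (\<Sum>j\<in>{1..d}. trunc (degree p) (k j) * q j)" for k y
    by (intro sum.cong) auto
  have Z: "Z = {k \<in> lattice_points (Suc d) p q. ?N dvd k (Suc d)}"
  proof (intro equalityI subsetI)
    fix k assume "k \<in> Z"
    then obtain y k' where k: "k = k'(Suc d := y)" "?N dvd y" "k' \<in> lattice_points d p q"
      by (auto simp: Z_def)
    have "k \<in> {1..Suc d} \<rightarrow>\<^sub>E UNIV"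
      using k(3) unfolding k(1) ins by (intro PiE_fun_upd) (auto simp: lattice_points_def)
    moreover have "\<exists>j\<in>{1..Suc d}. \<not> ?N dvd k j"
    proof -
      obtain j where "j \<in> {1..d}" "\<not> ?N dvd k' j"
        using k(3) by (auto simp: lattice_points_def)
      then show ?thesis by (intro bexI[of _ j]) (auto simp: k(1))
    qed
    moreover have "(trunc (degree p) y :: 'b mod_ring poly) = 0"
      using k by (simp add: trunc_eq_0_iff)
    then have "p dvd (\<Sum>j\<in>{1..Suc d}. trunc (degree p) (k j) * q j)"
      using k upd[of k' y] by (simp add: ins lattice_points_def del: fun_upd_apply) simp
    ultimately show "k \<in> {k \<in> lattice_points (Suc d) p q. ?N dvd k (Suc d)}"
      using k by (simp add: lattice_points_def)
  next
    fix k assume k: "k \<in> {k \<in> lattice_points (Suc d) p q. ?N dvd k (Suc d)}"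
    define k' where "k' = k(Suc d := undefined)"
    have kE: "k \<in> {1..Suc d} \<rightarrow>\<^sub>E UNIV" using k by (simp add: lattice_points_def)
    then have "k' \<in> {1..d} \<rightarrow>\<^sub>E UNIV"
      by (auto simp: k'_def PiE_def extensional_def)
    moreover have "\<exists>j\<in>{1..d}. \<not> ?N dvd k' j"
    proof -
      obtain j where j: "j \<in> {1..Suc d}" "\<not> ?N dvd k j"
        using k by (auto simp: lattice_points_def)
      then have "j \<noteq> Suc d" using k by auto
      then show ?thesis using j by (intro bexI[of _ j]) (auto simp: k'_def)
    qed
    moreover have "(trunc (degree p) (k (Suc d)) :: 'b mod_ring poly) = 0"
      using k by (simp add: trunc_eq_0_iff)
    then have "p dvd (\<Sum>j\<in>{1..d}. trunc (degree p) (k' j) * q j)"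
      using k unfolding k'_def upd by (simp add: ins lattice_points_def)
    ultimately have "k' \<in> lattice_points d p q" by (simp add: lattice_points_def)
    then show "k \<in> Z"
      unfolding Z_def using k by (intro image_eqI[of _ _ "(k (Suc d), k')"]) (auto simp: k'_def)
  qed
  have "f (Suc d) summable_on {y. ?N dvd y}"
    using f(2) by (rule summable_on_subset) simp
  then have ZS: "(?h (Suc d) has_sum (infsum (f (Suc d)) {y. ?N dvd y} * infsum (?h d) (lattice_points d p q))) Z"
    unfolding Z_def ins using summ f
    by (intro has_sum_prod_insert) (auto simp: lattice_points_def)
  have AS: "(?h (Suc d) has_sum infsum (?h (Suc d)) (active_points (Suc d) p q)) (active_points (Suc d) p q)"
    using summable_on_subset[OF summ[of "Suc d"]] by (intro has_sum_infsum) (auto simp: active_points_def)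
  have disj: "Z \<inter> active_points (Suc d) p q = {}"
    by (auto simp: Z active_points_def)
  have un: "Z \<union> active_points (Suc d) p q = lattice_points (Suc d) p q"
    by (auto simp: Z active_points_def)
  show ?thesis
    using infsumI[OF has_sum_Un_disjoint[OF ZS AS disj]] by (simp only: un)
qed

text \<open>
  A given vector \<open>k\<close> is active for at most one \<open>r \<in> R\<close>: if it were for \<open>r\<close> and \<open>r'\<close>, the irreducible
  polynomial \<open>p\<close> would divide the product of the nonzero truncation of the last coordinate with \<open>r - r'\<close>, and both
  factors have degree below \<open>degree p\<close>. The sets of active points are therefore disjoint subsets
  of the box of all vectors whose last coordinate is not divisible by \<open>b ^ m\<close>.
\<close>

lemma sum_active_points_le:
  fixes p :: "'b::prime_card mod_ring poly" and f :: "nat \<Rightarrow> nat \<Rightarrow> real"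
  assumes p: "Factorial_Ring.irreducible p"
    and f: "\<And>j k. f j k \<ge> 0" "\<And>j. f j summable_on UNIV"
    and R: "finite R" "R \<subseteq> polys_below (degree p)"
  shows "(\<Sum>r\<in>R. infsum (\<lambda>k. \<Prod>j\<in>{1..Suc d}. f j (k j)) (active_points (Suc d) p (q(Suc d := r))))
    \<le> infsum (f (Suc d)) {y. \<not> CARD('b) ^ degree p dvd y} * (\<Prod>j\<in>{1..d}. infsum (f j) UNIV)"
proof -
  let ?N = "CARD('b) ^ degree p"
  let ?h = "\<lambda>d k. \<Prod>j\<in>{1..d}. f j (k j)"
  let ?T = "\<lambda>r. active_points (Suc d) p (q(Suc d := r))"
  define X where "X = (\<lambda>(y, k). k(Suc d := y)) ` ({y. \<not> ?N dvd y} \<times> ({1..d} \<rightarrow>\<^sub>E UNIV))"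
  have ins: "{1..Suc d} = insert (Suc d) {1..d}" by auto
  have "f (Suc d) summable_on {y. \<not> ?N dvd y}"
    using f(2) by (rule summable_on_subset) simp
  then have X: "(?h (Suc d) has_sum (infsum (f (Suc d)) {y. \<not> ?N dvd y} * (\<Prod>j\<in>{1..d}. infsum (f j) UNIV))) X"
    unfolding X_def ins using f
    by (intro has_sum_prod_insert has_sum_prod_PiE) auto
  have sub: "?T r \<subseteq> X" for r
  proof
    fix k assume k: "k \<in> ?T r"
    then have "k(Suc d := undefined) \<in> {1..d} \<rightarrow>\<^sub>E UNIV"
      by (auto simp: active_points_def lattice_points_def PiE_def extensional_def)
    then show "k \<in> X"
      unfolding X_def using k
      by (intro image_eqI[of _ _ "(k (Suc d), k(Suc d := undefined))"]) (auto simp: active_points_def)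
  qed
  have disj: "?T r \<inter> ?T r' = {}" if "r \<in> R" "r' \<in> R" "r \<noteq> r'" for r r'
  proof (rule ccontr)
    assume "?T r \<inter> ?T r' \<noteq> {}"
    then obtain k where k: "k \<in> ?T r" "k \<in> ?T r'" by auto
    define a where "a = (\<Sum>j\<in>{1..d}. trunc (degree p) (k j) * q j)"
    define t where "t = (trunc (degree p) (k (Suc d)) :: 'b mod_ring poly)"
    have "p dvd a + t * r''" if "k \<in> ?T r''" for r''
    proof -
      have "(\<Sum>j\<in>{1..d}. trunc (degree p) (k j) * (q(Suc d := r'')) j) = a"
        unfolding a_def by (intro sum.cong) auto
      then show ?thesis
        using that by (simp add: active_points_def lattice_points_def ins t_def add.commute)
    qed
    then have "p dvd (a + t * r) - (a + t * r')" using k by (intro dvd_diff) auto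
    then have "p dvd t * (r - r')" by (simp add: algebra_simps)
    then have "p dvd t \<or> p dvd r - r'"
      by (rule prime_elem_dvd_multD[OF field_poly_irreducible_imp_prime[OF p]])
    then show False
    proof
      assume "p dvd t"
      then have "t = 0"
        unfolding t_def by (rule dvd_polys_below_imp_0[OF trunc_in_polys_below])
      then show False
        using k by (simp add: t_def trunc_eq_0_iff active_points_def)
    next
      assume "p dvd r - r'"
      moreover have "r - r' \<in> polys_below (degree p)"
        using that R(2) by (intro diff_in_polys_below) auto
      ultimately have "r - r' = 0" by (intro dvd_polys_below_imp_0)
      then show False using \<open>r \<noteq> r'\<close> by simp
    qed
  qed
  have summ: "?h (Suc d) summable_on ?T r" for r
    using summable_on_subset[OF has_sum_imp_summable[OF X] sub] .
  have "(\<Sum>r\<in>R. infsum (?h (Suc d)) (?T r)) = infsum (?h (Suc d)) (\<Union>r\<in>R. ?T r)"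
    using R(1) summ disj by (rule sum_infsum)
  also have "\<dots> \<le> infsum (?h (Suc d)) X"
  proof (rule infsum_mono2)
    show "?h (Suc d) summable_on (\<Union>r\<in>R. ?T r)"
      by (rule summable_on_subset[OF has_sum_imp_summable[OF X]]) (use sub in blast)
    show "?h (Suc d) summable_on X" using X by (rule has_sum_imp_summable)
    show "(\<Union>r\<in>R. ?T r) \<subseteq> X" using sub by blast
    show "?h (Suc d) k \<ge> 0" for k using f(1) by (intro prod_nonneg) simp
  qed
  also have "\<dots> = infsum (f (Suc d)) {y. \<not> ?N dvd y} * (\<Prod>j\<in>{1..d}. infsum (f j) UNIV)"
    using X by (rule infsumI)
  finally show ?thesis .
qed

text \<open>
  The criterion at \<open>Suc d\<close> is \<open>D * B d q + \<theta> q\<close>, where \<open>\<theta>\<close>, the sum over the active points, alone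
  depends on the new component. So the minimiser of the criterion minimises \<open>\<theta>\<close>, and \<open>\<theta> q powr lam\<close>
  is at most the average of \<open>\<theta> powr lam\<close> over the \<open>N - 1\<close> nonzero polynomials of degree
  below \<open>degree p\<close>. Jensen's inequality moves the power inside all sums, after which the two parts
  of the bound contain the multiples and the non-multiples of \<open>N\<close> and add up to one
  more factor of the product.
\<close>

lemma cbc_step:
  fixes p :: "'b::prime_card mod_ring poly" and f :: "nat \<Rightarrow> nat \<Rightarrow> real"
  defines "N \<equiv> CARD('b) ^ degree p"
  defines "B \<equiv> \<lambda>d q. infsum (\<lambda>k. \<Prod>j\<in>{1..d}. f j (k j)) (lattice_points d p q)"
  assumes p: "Factorial_Ring.irreducible p" "degree p \<ge> 1"
    and lam: "0 < lam" "lam \<le> 1"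
    and f: "\<And>j k. f j k \<ge> 0" "\<And>j. f j summable_on UNIV"
    and fl: "\<And>j. (\<lambda>k. f j k powr lam) summable_on UNIV"
    and min: "\<And>r. r \<in> polys_below_nz (degree p) \<Longrightarrow> B (Suc d) q \<le> B (Suc d) (q(Suc d := r))"
    and IH: "B d q powr lam \<le> (\<Prod>j\<in>{1..d}. infsum (\<lambda>k. f j k powr lam) UNIV) / (real N - 1)"
  shows "B (Suc d) q powr lam \<le> (\<Prod>j\<in>{1..Suc d}. infsum (\<lambda>k. f j k powr lam) UNIV) / (real N - 1)"
proof -
  define \<theta> where "\<theta> = (\<lambda>q. infsum (\<lambda>k. \<Prod>j\<in>{1..Suc d}. f j (k j)) (active_points (Suc d) p q))"
  define F where "F = (\<lambda>j k. f j k powr lam)"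
  define D where "D = infsum (f (Suc d)) {y. N dvd y}"
  \<comment> \<open>All nonzero polynomials of degree below \<open>degree p\<close>, enumerated by their digit codes, which makes
    their number evident.\<close>
  define R where "R = (trunc (degree p) ` {1..<N} :: 'b mod_ring poly set)"
  let ?P = "\<Prod>j\<in>{1..d}. infsum (F j) UNIV"
  have N: "N > 1" unfolding N_def using p(2) by (intro one_less_power card_gt_1) simp
  have Fnn: "F j k \<ge> 0" and Fsum: "F j summable_on UNIV" for j k
    using fl by (auto simp: F_def)
  have split: "B (Suc d) q' = D * B d q' + \<theta> q'" for q'
    unfolding B_def \<theta>_def D_def N_def using f by (rule infsum_lattice_points_Suc)
  have Bnn: "B d q \<ge> 0" and Dnn: "D \<ge> 0" and \<theta>nn: "\<theta> q \<ge> 0"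
    unfolding B_def D_def \<theta>_def by (intro infsum_nonneg prod_nonneg f(1))+
  have "inj_on (trunc (degree p) :: nat \<Rightarrow> 'b mod_ring poly) {1..<N}"
    by (rule inj_onI) (simp add: trunc_eq_iff N_def)
  then have cardR: "card R = N - 1" unfolding R_def by (subst card_image) auto
  have R: "finite R" "R \<noteq> {}" "R \<subseteq> polys_below (degree p)"
    using N by (auto simp: R_def trunc_in_polys_below)
  have R_nz: "R \<subseteq> polys_below_nz (degree p)"
  proof
    fix r assume r: "r \<in> R"
    then obtain k where k: "k \<in> {1..<N}" "r = trunc (degree p) k" by (auto simp: R_def)
    then have "\<not> N dvd k" by (auto dest: dvd_imp_le)
    then have "r \<noteq> 0" by (simp add: k(2) trunc_eq_0_iff N_def)
    then show "r \<in> polys_below_nz (degree p)" using r R(3) by (auto simp: polys_below_nz_def)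
  qed
  have \<theta>_min: "\<theta> q \<le> \<theta> (q(Suc d := r))" if "r \<in> R" for r
  proof -
    have "lattice_points d p (q(Suc d := r)) = lattice_points d p q"
      by (rule lattice_points_cong) simp
    then have "B d (q(Suc d := r)) = B d q" by (simp only: B_def)
    moreover have "r \<in> polys_below_nz (degree p)" using that R_nz by blast
    then have "B (Suc d) q \<le> B (Suc d) (q(Suc d := r))" by (rule min)
    ultimately show ?thesis by (simp only: split)
  qed
  have avg: "\<theta> q powr lam \<le> (\<Sum>r\<in>R. \<theta> (q(Suc d := r)) powr lam) / real (card R)"
    using R(1,2) less_imp_le[OF lam(1)] \<theta>nn \<theta>_min by (rule powr_le_average)
  have "(\<Sum>r\<in>R. \<theta> (q(Suc d := r)) powr lam) \<le>
     (\<Sum>r\<in>R. infsum (\<lambda>k. \<Prod>j\<in>{1..Suc d}. F j (k j)) (active_points (Suc d) p (q(Suc d := r))))"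
  proof (rule sum_mono)
    fix r assume "r \<in> R"
    have "(\<lambda>k. \<Prod>j\<in>{1..Suc d}. F j (k j)) summable_on ({1..Suc d} \<rightarrow>\<^sub>E UNIV)"
      using Fnn Fsum by (intro has_sum_imp_summable[OF has_sum_prod_PiE]) auto
    then have "(\<lambda>k. \<Prod>j\<in>{1..Suc d}. F j (k j)) summable_on active_points (Suc d) p (q(Suc d := r))"
      by (rule summable_on_subset) (auto simp: active_points_def lattice_points_def)
    then show "\<theta> (q(Suc d := r)) powr lam \<le>
        infsum (\<lambda>k. \<Prod>j\<in>{1..Suc d}. F j (k j)) (active_points (Suc d) p (q(Suc d := r)))"
      unfolding \<theta>_def F_def prod_powr_distrib[symmetric]
      by (intro infsum_powr_le lam prod_nonneg f(1))
  qed
  also have "\<dots> \<le> infsum (F (Suc d)) {y. \<not> N dvd y} * ?P"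
    unfolding N_def using p(1) Fnn Fsum R(1,3) by (rule sum_active_points_le)
  finally have "(\<Sum>r\<in>R. \<theta> (q(Suc d := r)) powr lam) / real (card R)
      \<le> infsum (F (Suc d)) {y. \<not> N dvd y} * ?P / real (card R)"
    by (rule divide_right_mono) simp
  then have \<theta>_le: "\<theta> q powr lam \<le> infsum (F (Suc d)) {y. \<not> N dvd y} * ?P / (real N - 1)"
    using avg N by (simp add: cardR of_nat_diff)
  have "D powr lam \<le> infsum (F (Suc d)) {y. N dvd y}"
    unfolding D_def F_def
    by (intro infsum_powr_le lam f(1) summable_on_subset[OF fl]) simp
  then have "(D * B d q) powr lam \<le> infsum (F (Suc d)) {y. N dvd y} * (?P / (real N - 1))"
    unfolding powr_mult using IH by (intro mult_mono) (auto simp: F_def infsum_nonneg)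
  moreover have "B (Suc d) q powr lam \<le> (D * B d q) powr lam + \<theta> q powr lam"
    unfolding split using lam Dnn Bnn \<theta>nn by (intro powr_add_le) auto
  ultimately have "B (Suc d) q powr lam \<le>
      (infsum (F (Suc d)) {y. N dvd y} + infsum (F (Suc d)) {y. \<not> N dvd y}) * ?P / (real N - 1)"
    using \<theta>_le by (simp add: ring_distribs add_divide_distrib)
  also have "infsum (F (Suc d)) {y. N dvd y} + infsum (F (Suc d)) {y. \<not> N dvd y} =
      infsum (F (Suc d)) ({y. N dvd y} \<union> {y. \<not> N dvd y})"
    using summable_on_subset[OF Fsum] by (intro infsum_Un_disjoint[symmetric]) auto
  also have "{y. N dvd y} \<union> {y. \<not> N dvd y} = UNIV" by auto
  also have "infsum (F (Suc d)) UNIV * ?P = (\<Prod>j\<in>{1..Suc d}. infsum (F j) UNIV)"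
    by (simp add: mult.commute)
  finally show ?thesis by (simp add: F_def)
qed

section \<open>The bound\<close>

text \<open>
  With \<open>q 1 = 1\<close> the polynomial \<open>p\<close> would have to divide the truncation of \<open>k 1\<close>, which is nonzero of
  smaller degree. So the first step of the construction has error zero.
\<close>

lemma lattice_points_1_eq_empty:
  assumes "q 1 = 1"
  shows "lattice_points 1 p q = {}"
  using assms dvd_polys_below_imp_0[OF trunc_in_polys_below]
  by (auto simp: lattice_points_def trunc_eq_0_iff)

theorem theorem4:
  fixes b m s \<alpha> d :: nat
    and \<gamma> :: "nat \<Rightarrow> real"
    and p :: "'b::prime_card mod_ring poly"
    and q :: "nat \<Rightarrow> 'b mod_ring poly"
    and lam :: real
  assumes "b = CARD('b)"
    and "m \<ge> 1" and "s \<ge> 1" and "\<alpha> \<ge> 2"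
    and "\<And>j. j \<ge> 1 \<Longrightarrow> \<gamma> j \<ge> 0"
    and "degree p = m"
    and "\<And>j. j \<in> {1..s} \<Longrightarrow> q j \<in> polys_below_nz m"
    and "cbc_output \<alpha> (product_weight \<gamma>) s p q"
    and "1 \<le> d" and "d \<le> s"
    and "1 / real \<alpha> < lam" and "lam \<le> 1"
  shows "B_crit \<alpha> (product_weight \<gamma>) d p q
    \<le> 1 / (real b ^ m - 1) powr (1 / lam)
      * (\<Prod>j = 1..d. (1 + \<gamma> j powr lam * C_const b \<alpha> powr lam * E_const b \<alpha> lam) powr (1 / lam))"
proof -
  note b_def = \<open>b = CARD('b)\<close> and \<alpha> = \<open>\<alpha> \<ge> 2\<close> and \<gamma> = \<open>\<And>j. j \<ge> 1 \<Longrightarrow> \<gamma> j \<ge> 0\<close>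
    and deg = \<open>degree p = m\<close> and cbc = \<open>cbc_output \<alpha> (product_weight \<gamma>) s p q\<close>
    and lam_gt = \<open>1 / real \<alpha> < lam\<close>
  \<comment> \<open>Index \<open>0\<close> is not a coordinate and \<open>\<gamma> 0\<close> may be negative; the weight \<open>0\<close> there keeps \<open>f\<close> nonnegative.\<close>
  define f where "f = (\<lambda>j. coord_weight b \<alpha> 1 (if j \<ge> 1 then \<gamma> j * C_const b \<alpha> else 0))"
  define B where "B = (\<lambda>d q. infsum (\<lambda>k. \<Prod>j\<in>{1..d}. f j (k j)) (lattice_points d p q))"
  define S where "S = (\<lambda>j. infsum (\<lambda>k. f j k powr lam) UNIV)"
  have b: "b > 1" using card_gt_1 by (simp add: b_def)
  have C: "C_const b \<alpha> \<ge> 0" using b by (rule C_const_nonneg)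
  have "0 < 1 / real \<alpha>" using \<alpha> by simp
  then have lam: "0 < lam" using lam_gt by linarith
  have B_crit: "B_crit \<alpha> (product_weight \<gamma>) n p q' = B n q'" for n q'
  proof -
    have "B_crit \<alpha> (product_weight \<gamma>) n p q' = infsum (\<lambda>k. \<Prod>j\<in>{1..n}.
        coord_weight b \<alpha> 1 (\<gamma> j * C_const b \<alpha>) (k j)) (lattice_points n p q')"
      unfolding b_def using \<alpha> \<gamma> by (intro B_crit_eq_infsum_lattice_points) auto
    also have "\<dots> = B n q'"
      unfolding B_def f_def by (intro infsum_cong prod.cong) auto
    finally show ?thesis .
  qed
  have fnn: "f j k \<ge> 0" for j k
    using C \<gamma> by (simp add: f_def coord_weight_nonneg)
  have fsum: "f j summable_on UNIV" for j
    unfolding f_def using b \<alpha> C \<gamma> by (intro summable_coord_weight) auto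
  have flsum: "(\<lambda>k. f j k powr lam) summable_on UNIV" for j
    unfolding f_def coord_weight_powr using b \<alpha> lam_gt by (intro summable_coord_weight) auto
  have S: "S j = 1 + \<gamma> j powr lam * C_const b \<alpha> powr lam * E_const b \<alpha> lam" if "j \<ge> 1" for j
    unfolding S_def f_def coord_weight_powr using b \<alpha> lam_gt that
    by (simp add: infsum_coord_weight powr_mult)
  have Snn: "S j \<ge> 0" for j by (simp add: S_def infsum_nonneg)
  have bm: "real b ^ m - 1 > 0"
    using one_less_power[of "real b" m] b \<open>m \<ge> 1\<close> by simp
  have "B d q powr lam \<le> (\<Prod>j\<in>{1..d}. S j) / (real b ^ m - 1)"
    using \<open>1 \<le> d\<close> \<open>d \<le> s\<close>
  proof (induction d rule: nat_induct_at_least)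
    case base
    have "B 1 q = 0"
      unfolding B_def using cbc by (simp add: lattice_points_1_eq_empty cbc_output_def del: One_nat_def)
    then show ?case using Snn bm by (simp add: prod_nonneg)
  next
    case (Suc n)
    have "B (Suc n) q \<le> B (Suc n) (q(Suc n := r))" if "r \<in> polys_below_nz (degree p)" for r
    proof -
      have "Suc n \<in> {2..s}" using Suc by auto
      then have "is_arg_min (\<lambda>r. B (Suc n) (q(Suc n := r)))
          (\<lambda>r. r \<in> polys_below_nz (degree p)) (q (Suc n))"
        using cbc unfolding cbc_output_def B_crit by blast
      then show ?thesis using that by (simp add: is_arg_min_linorder)
    qed
    then show ?case
      using cbc_step[of p lam f n q] cbc deg lam \<open>lam \<le> 1\<close> \<open>m \<ge> 1\<close> fnn fsum flsum Suc
      by (simp add: B_def S_def cbc_output_def b_def)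
  qed
  then have "(B d q powr lam) powr (1 / lam) \<le> ((\<Prod>j\<in>{1..d}. S j) / (real b ^ m - 1)) powr (1 / lam)"
    using lam by (intro powr_mono2) auto
  moreover have "B d q \<ge> 0"
    unfolding B_def using fnn by (intro infsum_nonneg prod_nonneg) auto
  ultimately have "B d q \<le> ((\<Prod>j\<in>{1..d}. S j) / (real b ^ m - 1)) powr (1 / lam)"
    using lam by (simp add: powr_powr)
  also have "\<dots> = 1 / (real b ^ m - 1) powr (1 / lam) * (\<Prod>j\<in>{1..d}. S j powr (1 / lam))"
    using Snn bm by (simp add: powr_divide prod_nonneg prod_powr_distrib)
  also have "(\<Prod>j\<in>{1..d}. S j powr (1 / lam)) =
      (\<Prod>j = 1..d. (1 + \<gamma> j powr lam * C_const b \<alpha> powr lam * E_const b \<alpha> lam) powr (1 / lam))"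
    by (intro prod.cong refl) (simp add: S)
  finally show ?thesis by (simp add: B_crit)
qed

end
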